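(* Let $L$ be a finite set of positive integers, $G$ a connected graph and $u$ a vertex of $G$. Define $f_{L,G,u}:\mathbb{N}\to\mathbb{N}$ by $f_{L,G,u}(k)=\mathcal{G}_L(G\oplus_u P_k)$. Then $f_{L,G,u}$ is ultimately periodic: there exist integers $T>0$ and $k_0\ge 0$ such that $f_{L,G,u}(k+T)=f_{L,G,u}(k)$ for all $k\ge k_0$.
   Context: For a set $L$ of positive integers, the game $CSG(L)$ on a connected graph $G$ is the two-player impartial game in which a move consists in removing from the current graph a connected subgraph $H$ (i.e. deleting the vertices of $H$) such that $|V(H)|\in L$ and the remaining graph is connected (the empty graph counts as connected, so removing the whole graph is allowed when its number of vertices is in $L$). The player unable to move loses. $\mathcal{G}_L(G)$ denotes the Grundy value of $CSG(L)$ played on $G$ (defined recursively as the mex of the Grundy values of the options, $0$ if no move). $P_k$ is the path on $k$ vertices. For a graph $G$, a vertex $u$ and $k\ge 0$, $G\oplus_u P_k$ denotes the graph obtained from $G$ by appending a path of $k$ new vertices to $u$ (one endpoint of the new path adjacent to $u$; $u$ is not part of the path); if $G$ is empty, $G\oplus_u P_k=P_k$. *)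

theory Defs
  imports "Graph_Theory.Digraph_Component"
begin

text \<open>
  Finite simple graphs are symmetric loop-free digraphs, as in the locales \<^locale>\<open>graph\<close> and
  \<^locale>\<open>pair_graph\<close>. The null graph satisfies these locales, but \<^const>\<open>connected\<close> excludes it;
  hence the removed subgraph below is nonempty, and the case of an empty remaining graph is
  allowed separately. Requiring \<^term>\<open>graph G\<close> keeps the game on finite graphs, where it terminates.
\<close>

definition csg_move :: "nat set \<Rightarrow> ('a, 'b) pre_digraph \<Rightarrow> ('a, 'b) pre_digraph \<Rightarrow> bool" where
  "csg_move L G G' \<longleftrightarrow> graph G \<and>
     (\<exists>H. graph H \<and> subgraph H G \<and> connected H \<and> card (verts H) \<in> L \<and>
          G' = G \<restriction> (verts G - verts H) \<and> (verts G' = {} \<or> connected G'))"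

definition mex :: "nat set \<Rightarrow> nat" where
  "mex A = (LEAST n. n \<notin> A)"

lemma csg_move_card_less:
  assumes "csg_move L G G'"
  shows "card (verts G') < card (verts G)"
proof -
  from assms obtain H where G: "graph G" and H: "subgraph H G" "connected H"
    and G': "G' = G \<restriction> (verts G - verts H)"
    unfolding csg_move_def by blast
  interpret graph G by (fact G)
  have "verts H \<noteq> {}"
    using H(2) by (simp add: connected_conv)
  moreover have "verts H \<subseteq> verts G"
    using H(1) by (rule subgraph_imp_subverts)
  ultimately have "verts G' \<subset> verts G"
    using G' by auto
  then show ?thesis
    by (intro psubset_card_mono) simp_all
qed

function grundy :: "nat set \<Rightarrow> ('a, 'b) pre_digraph \<Rightarrow> nat" where
  "grundy L G = mex (grundy L ` {G'. csg_move L G G'})"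
  by pat_completeness auto
termination
  by (relation "measure (\<lambda>(L, G). card (verts G))") (auto intro: csg_move_card_less)

declare grundy.simps [simp del]

text \<open>
  The vertices of the appended path are \<open>Inr 0, \<dots>, Inr (k - 1)\<close>, with \<open>Inr 0\<close> adjacent to \<open>u\<close>.
  If \<open>G\<close> is the null graph there is no joining edge and the result is the path itself.
\<close>

definition append_path :: "'a pair_pre_digraph \<Rightarrow> 'a \<Rightarrow> nat \<Rightarrow> ('a + nat) pair_pre_digraph" where
  "append_path G u k =
     \<lparr> pverts = Inl ` pverts G \<union> Inr ` {..<k},
       parcs = ({(Inl v, Inl w) |v w. (v, w) \<in> parcs G}
         \<union> {(Inr i, Inr (Suc i)) |i. Suc i < k}
         \<union> (if u \<in> pverts G \<and> 0 < k then {(Inl u, Inr 0)} else {}))\<^sup>s \<rparr>"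

lemma pair_graph_append_path:
  assumes "pair_graph G"
  shows "pair_graph (append_path G u k)"
proof -
  interpret pair_graph G by (fact assms)
  let ?V = "Inl ` pverts G \<union> Inr ` {..<k}"
  have arcs: "parcs (append_path G u k) \<subseteq> ?V \<times> ?V"
    by (auto simp: append_path_def symcl_def dest: in_arcsD1 in_arcsD2 split: if_splits)
  show ?thesis
  proof
    show "finite (pverts (append_path G u k))"
      by (simp add: append_path_def)
    show "finite (parcs (append_path G u k))"
      by (rule finite_subset [OF arcs]) simp
    show "symmetric (append_path G u k)"
      by (auto simp: symmetric_def append_path_def symcl_def sym_def split: if_splits)
  next
    fix e
    assume e: "e \<in> parcs (append_path G u k)"
    from e arcs show "fst e \<in> pverts (append_path G u k)" "snd e \<in> pverts (append_path G u k)"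
      by (auto simp: append_path_def)
    from e show "fst e \<noteq> snd e"
      by (auto simp: append_path_def symcl_def dest: no_loops' split: if_splits)
  qed
qed

definition csg_path_fun :: "nat set \<Rightarrow> 'a pair_pre_digraph \<Rightarrow> 'a \<Rightarrow> nat \<Rightarrow> nat" where
  "csg_path_fun L G u k = grundy L (with_proj (append_path G u k))"

end

theory Submission
  imports Defs
begin

text \<open>
  Every position is an induced subgraph of one infinite host graph, \<open>G\<close> with a ray attached at \<open>u\<close>.
  Once \<open>k\<close> exceeds all elements of \<open>L\<close>, a move on \<open>W\<close> with a path of length \<open>k\<close> appended either
  shortens the path by some \<open>l \<in> L\<close>, or removes part of \<open>W\<close> keeping \<open>u\<close>, or removes all of \<open>W\<close>
  together with an initial piece of the path. By induction on \<open>W\<close> the last two kinds of options have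
  ultimately periodic values, so the Grundy value at \<open>k\<close> is the mex of finitely many of its
  predecessors together with an ultimately periodic finite set. Such a sequence is bounded, and the
  pigeonhole principle applied to (residue of \<open>k\<close>, window of recent values) makes it ultimately periodic.
\<close>

section \<open>Ultimately periodic sequences\<close>

definition ult_periodic :: "(nat \<Rightarrow> 'b) \<Rightarrow> bool" where
  "ult_periodic f \<longleftrightarrow> (\<exists>T>0. \<exists>k\<^sub>0. \<forall>k\<ge>k\<^sub>0. f (k + T) = f k)"

lemma periodic_add_mult:
  fixes f :: "nat \<Rightarrow> 'b"
  assumes "\<forall>k\<ge>k\<^sub>0. f (k + T) = f k" and "k\<^sub>0 \<le> k"
  shows "f (k + c * T) = f k"
proof (induction c)
  case (Suc c)
  have "f (k + Suc c * T) = f (k + c * T + T)" by (simp add: algebra_simps)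
  also have "\<dots> = f k" using assms Suc by simp
  finally show ?case .
qed simp

lemma periodic_cong_mod:
  fixes f :: "nat \<Rightarrow> 'b"
  assumes "\<forall>k\<ge>k\<^sub>0. f (k + T) = f k" and "k\<^sub>0 \<le> a" "k\<^sub>0 \<le> b" and "a mod T = b mod T"
  shows "f a = f b"
  using assms(2-)
proof (induction a b rule: linorder_wlog)
  case (le a b)
  then obtain c where "b = a + c * T"
    by (metis mod_eq_nat2E mult.commute)
  with periodic_add_mult [OF assms(1), of a c] le show ?case by simp
qed simp

text \<open>Every argument past \<open>k\<^sub>0\<close> reduces to a representative within one
  period. This later bounds the sizes of all the sets \<open>X k\<close> uniformly.\<close>

lemma ult_periodic_finite_range:
  assumes "ult_periodic f"
  shows "finite (range f)"
proof -
  from assms obtain T k\<^sub>0 where T: "T > 0" and per: "\<forall>k\<ge>k\<^sub>0. f (k + T) = f k"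
    unfolding ult_periodic_def by blast
  have "f k \<in> f ` {..<k\<^sub>0 + T}" for k
  proof (cases "k < k\<^sub>0")
    case False
    define r where "r = k\<^sub>0 + (k - k\<^sub>0) mod T"
    have "k = r + (k - k\<^sub>0) div T * T" using False by (simp add: r_def)
    then have "f k = f r" using periodic_add_mult [OF per, of r] by (metis le_add1 r_def)
    then show ?thesis using T by (auto simp: r_def)
  qed simp
  then have "range f \<subseteq> f ` {..<k\<^sub>0 + T}" by blast
  then show ?thesis by (rule finite_subset) simp
qed

lemma ult_periodic_const: "ult_periodic (\<lambda>k. c)"
  unfolding ult_periodic_def by auto

lemma ult_periodic_comp:
  assumes "ult_periodic f"
  shows "ult_periodic (\<lambda>k. h (f k))"
  using assms unfolding ult_periodic_def by metis

lemma ult_periodic_shift: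
  assumes "ult_periodic f"
  shows "ult_periodic (\<lambda>k. f (k - a))"
proof -
  from assms obtain T k\<^sub>0 where T: "T > 0" and per: "\<forall>k\<ge>k\<^sub>0. f (k + T) = f k"
    unfolding ult_periodic_def by blast
  have "f (k + T - a) = f (k - a)" if "k \<ge> k\<^sub>0 + a" for k
    using per [rule_format, of "k - a"] that by simp
  with T show ?thesis unfolding ult_periodic_def by blast
qed

lemma ult_periodic_Un:
  assumes "ult_periodic X" "ult_periodic Y"
  shows "ult_periodic (\<lambda>k. X k \<union> Y k)"
proof -
  from assms obtain T k\<^sub>0 T' k\<^sub>0' where T: "T > 0" "T' > 0"
    and per: "\<forall>k\<ge>k\<^sub>0. X (k + T) = X k" "\<forall>k\<ge>k\<^sub>0'. Y (k + T') = Y k"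
    unfolding ult_periodic_def by blast
  \<comment> \<open>The product of the two periods is a common period.\<close>
  have "X (k + T' * T) \<union> Y (k + T' * T) = X k \<union> Y k" if "k \<ge> max k\<^sub>0 k\<^sub>0'" for k
    using periodic_add_mult [OF per(1), of k T'] periodic_add_mult [OF per(2), of k T] that
    by (simp add: mult.commute)
  with T show ?thesis unfolding ult_periodic_def
    by (meson mult_pos_pos)
qed

lemma ult_periodic_UN:
  assumes "finite I" and "\<And>i. i \<in> I \<Longrightarrow> ult_periodic (X i)"
  shows "ult_periodic (\<lambda>k. \<Union>i\<in>I. X i k)"
  using assms by (induction I rule: finite_induct) (auto intro: ult_periodic_const ult_periodic_Un)

section \<open>Mex recursions with bounded memory\<close>

text \<open>The \<open>card A + 1\<close> numbers in \<open>{..card A}\<close> cannot all lie in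
  \<open>A\<close>.\<close>

lemma mex_le_card:
  assumes "finite A"
  shows "mex A \<le> card A"
proof -
  have "\<not> {..card A} \<subseteq> A"
    using card_mono [OF assms, of "{..card A}"] by auto
  then obtain n where "n \<le> card A" "n \<notin> A" by auto
  then show ?thesis unfolding mex_def by (meson Least_le order_trans)
qed

text \<open>The recursion looks back at most \<open>M\<close> steps, so a residue modulo the period
  of \<open>X\<close> and \<open>M\<close> consecutive values determine everything that follows. The
  mex bound leaves only finitely many such states, hence one of them recurs.\<close>

lemma ult_periodic_mex_recursion:
  fixes f :: "nat \<Rightarrow> nat"
  assumes L: "finite L" "\<And>l. l \<in> L \<Longrightarrow> 0 < l \<and> l \<le> M"
    and X: "ult_periodic X" "\<And>k. finite (X k)"
    and rec: "\<And>k. k > M \<Longrightarrow> f k = mex (X k \<union> (\<lambda>l. f (k - l)) ` L)"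
  shows "ult_periodic f"
proof -
  from X(1) obtain T k\<^sub>0 where T: "T > 0" and per: "\<forall>k\<ge>k\<^sub>0. X (k + T) = X k"
    unfolding ult_periodic_def by blast
  \<comment> \<open>From \<open>K\<close> on, both the periodicity of \<open>X\<close> and the
    recursion for \<open>f\<close> are available.\<close>
  define K where "K = max k\<^sub>0 (Suc M)"
  define B where "B = Max (card ` range X) + card L"
  have bound: "f k \<le> B" if "k \<ge> K" for k
  proof -
    have "f k \<le> card (X k \<union> (\<lambda>l. f (k - l)) ` L)"
      using that X(2) L(1) by (subst rec) (auto simp: K_def intro!: mex_le_card)
    also have "\<dots> \<le> card (X k) + card ((\<lambda>l. f (k - l)) ` L)" by (rule card_Un_le)
    also have "\<dots> \<le> B"
      unfolding B_def
      by (intro add_mono Max_ge card_image_le finite_imageI ult_periodic_finite_range X L) auto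
    finally show ?thesis .
  qed
  \<comment> \<open>The window starts at \<open>k\<close> and looks forward, so that for
    \<open>n \<ge> M\<close> the recursion at \<open>k + n\<close> refers only to indices at least
    \<open>k\<close>.\<close>
  define s where "s k = (k mod T, map f [k..<k + M])" for k
  have "s ` {K..} \<subseteq> {..<T} \<times> {xs. set xs \<subseteq> {..B} \<and> length xs = M}"
    using T bound by (auto simp: s_def)
  then have "finite (s ` {K..})"
    by (rule finite_subset) (intro finite_cartesian_product finite_lists_length_eq; simp)
  then have "\<not> inj_on s {K..}"
    using finite_imageD infinite_Ici by blast
  then obtain i j where ij: "K \<le> i" "i < j" "s i = s j"
    unfolding inj_on_def by (metis atLeast_iff linorder_neqE_nat)
  have eq: "f (i + n) = f (j + n)" for n
  proof (induction n rule: less_induct)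
    case (less n)
    show ?case
    proof (cases "n < M")
      case True
      have "map f [i..<i + M] ! n = map f [j..<j + M] ! n" using ij(3) by (simp add: s_def)
      with True show ?thesis by simp
    next
      case False
      have "(i + n) mod T = (j + n) mod T"
        using ij(3) by (metis mod_add_left_eq prod.inject s_def)
      then have "X (i + n) = X (j + n)"
        using ij by (intro periodic_cong_mod [OF per]) (auto simp: K_def)
      \<comment> \<open>Here \<open>0 < l \<le> M \<le> n\<close>, so \<open>n - l\<close> is a
        smaller index and the subtraction does not truncate.\<close>
      moreover have "f (i + n - l) = f (j + n - l)" if "l \<in> L" for l
        using less [of "n - l"] L(2) [OF that] False by simp
      moreover have "M < i + n" "M < j + n" using ij by (auto simp: K_def)
      ultimately show ?thesis by (simp add: rec cong: image_cong)
    qed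
  qed
  have "f (k + (j - i)) = f k" if "k \<ge> i" for k
    using eq [of "k - i"] that ij by (simp add: add.commute)
  then show ?thesis
    using ij(2) unfolding ult_periodic_def by (meson zero_less_diff)
qed

section \<open>The game on vertex sets of a host graph\<close>

text \<open>Restricting to \<open>S \<times> S\<close> lets one fixed relation, possibly infinite,
  host all positions, which are then determined by their vertex sets.\<close>

definition induced :: "'v rel \<Rightarrow> 'v set \<Rightarrow> ('v, 'v \<times> 'v) pre_digraph" where
  "induced E S = with_proj \<lparr>pverts = S, parcs = E \<inter> S \<times> S\<rparr>"

text \<open>Connectivity as reachability inside \<open>S\<close>, free of digraph records;
  nonemptiness is included to agree with \<open>connected\<close>.\<close>

definition conn :: "'v rel \<Rightarrow> 'v set \<Rightarrow> bool" where
  "conn E S \<longleftrightarrow> S \<noteq> {} \<and> (\<forall>x\<in>S. \<forall>y\<in>S. (x, y) \<in> (E \<inter> S \<times> S)\<^sup>*)"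

lemma verts_induced [simp]: "verts (induced E S) = S"
  by (simp add: induced_def)

lemma arcs_induced [simp]: "arcs (induced E S) = E \<inter> S \<times> S"
  by (simp add: induced_def)

lemma graph_induced:
  assumes "sym E" "irrefl E" "finite S"
  shows "graph (induced E S)"
proof -
  have "pair_graph \<lparr>pverts = S, parcs = E \<inter> S \<times> S\<rparr>"
    using assms by unfold_locales (auto simp: symmetric_def irrefl_def sym_def dest: finite_subset)
  then show ?thesis unfolding induced_def by (rule pair_graph.pair_graphD_graph)
qed

lemma induce_subgraph_induced:
  "T \<subseteq> S \<Longrightarrow> induced E S \<restriction> T = induced E T"
  by (auto simp: induced_def induce_subgraph_def with_proj_def)

lemma (in wf_digraph) connected_iff_rtrancl:
  "connected G \<longleftrightarrow>
    verts G \<noteq> {} \<and> (\<forall>x\<in>verts G. \<forall>y\<in>verts G. (x, y) \<in> (parcs (mk_symmetric G))\<^sup>*)"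
proof -
  interpret S: pair_wf_digraph "mk_symmetric G" ..
  show ?thesis
    using S.reachable_conv' by (auto simp: connected_def strongly_connected_def)
qed

lemma connected_with_proj_iff:
  assumes "sym (parcs H)" and "parcs H \<subseteq> pverts H \<times> pverts H"
  shows "connected (with_proj H) \<longleftrightarrow> conn (parcs H) (pverts H)"
proof -
  have "parcs (mk_symmetric (with_proj H)) = parcs H"
    using assms(1) by (auto simp: parcs_mk_symmetric sym_def)
  moreover have "parcs H \<inter> pverts H \<times> pverts H = parcs H"
    using assms(2) by blast
  moreover have "wf_digraph (with_proj H)"
    using assms(2) by unfold_locales auto
  ultimately show ?thesis by (simp add: wf_digraph.connected_iff_rtrancl conn_def)
qed

lemma connected_induced_iff:
  assumes "sym E"
  shows "connected (induced E S) \<longleftrightarrow> conn E S"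
proof -
  have "sym (E \<inter> S \<times> S)" using assms by (auto simp: sym_def)
  then show ?thesis
    unfolding induced_def by (subst connected_with_proj_iff) (auto simp: conn_def Int_assoc)
qed

text \<open>The removed \<open>H\<close> may have fewer edges than the host induces on its vertices,
  but only its vertex set affects the result. If \<open>H\<close> is connected, so is the induced
  subgraph on \<open>verts H\<close>; conversely, that induced subgraph can serve as
  \<open>H\<close>.\<close>

lemma csg_move_induced_iff:
  assumes E: "sym E" "irrefl E" and "finite A"
  shows "csg_move L (induced E A) G' \<longleftrightarrow>
    (\<exists>S\<subseteq>A. conn E S \<and> card S \<in> L \<and> (A - S = {} \<or> conn E (A - S)) \<and> G' = induced E (A - S))"
    (is "?l \<longleftrightarrow> ?r")
proof
  assume ?l
  then obtain H where H: "graph H" "subgraph H (induced E A)" "connected H" "card (verts H) \<in> L"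
    and G': "G' = induced E A \<restriction> (A - verts H)" "verts G' = {} \<or> connected G'"
    unfolding csg_move_def by auto
  have sub: "verts H \<subseteq> A" using H(2) by (auto simp: subgraph_def)
  \<comment> \<open>A subgraph shares \<open>tail\<close> and \<open>head\<close> with its host, so
    the arcs of \<open>H\<close> are themselves pairs of vertices.\<close>
  have ends: "tail H = fst" "head H = snd"
    using H(2) by (auto simp: subgraph_def compatible_def induced_def)
  interpret H: graph H by fact
  have "arcs H \<subseteq> E \<inter> verts H \<times> verts H"
    using H(2) H.wellformed by (auto simp: subgraph_def ends)
  moreover have "parcs (mk_symmetric H) \<subseteq> arcs_ends H"
    using H.adj_mk_symmetric_eq H.sym_arcs by auto
  moreover have "arcs_ends H = arcs H"
    by (auto simp: arcs_ends_def arc_to_ends_def ends)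
  ultimately have "(parcs (mk_symmetric H))\<^sup>* \<subseteq> (E \<inter> verts H \<times> verts H)\<^sup>*"
    by (intro rtrancl_mono) auto
  then have "conn E (verts H)"
    using H(3) by (auto simp: H.connected_iff_rtrancl conn_def)
  with H sub G' show ?r
    by (auto simp: induce_subgraph_induced connected_induced_iff [OF E(1)] intro!: exI [of _ "verts H"])
next
  assume ?r
  then obtain S where S: "S \<subseteq> A" "conn E S" "card S \<in> L" "A - S = {} \<or> conn E (A - S)"
    "G' = induced E (A - S)" by blast
  have fin: "finite S" using S(1) assms(3) by (rule finite_subset)
  note gr = graph_induced [OF E]
  have "subgraph (induced E S) (induced E A)"
    using S(1) gr [OF fin] gr [OF assms(3)]
    by (auto simp: subgraph_def compatible_def induced_def graph_def digraph_def fin_digraph_def)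
  with S gr [OF fin] gr [OF assms(3)] show ?l
    unfolding csg_move_def
    by (auto simp: induce_subgraph_induced connected_induced_iff [OF E(1)] intro!: exI [of _ "induced E S"])
qed

text \<open>An option is recorded by the set \<open>R\<close> of remaining vertices.\<close>

definition options :: "'v rel \<Rightarrow> nat set \<Rightarrow> 'v set \<Rightarrow> 'v set set" where
  "options E L A = {R. R \<subseteq> A \<and> (R = {} \<or> conn E R) \<and> conn E (A - R) \<and> card (A - R) \<in> L}"

definition gval :: "'v rel \<Rightarrow> nat set \<Rightarrow> 'v set \<Rightarrow> nat" where
  "gval E L A = grundy L (induced E A)"

text \<open>Complementation in \<open>A\<close> exchanges the removed set of a move with the
  remaining set of an option.\<close>

lemma gval_rec:
  assumes "sym E" "irrefl E" "finite A"
  shows "gval E L A = mex (gval E L ` options E L A)"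
proof -
  have "{G'. csg_move L (induced E A) G'} = induced E ` options E L A"
    (is "?l = ?r")
  proof (intro subset_antisym subsetI)
    fix G' assume "G' \<in> ?l"
    then obtain S where "S \<subseteq> A" "conn E S" "card S \<in> L" "A - S = {} \<or> conn E (A - S)"
      "G' = induced E (A - S)"
      by (auto simp: csg_move_induced_iff [OF assms])
    moreover from this have "A - (A - S) = S" by blast
    ultimately show "G' \<in> ?r"
      unfolding options_def by (intro image_eqI [of _ _ "A - S"]) auto
  next
    fix G' assume "G' \<in> ?r"
    then obtain R where "R \<in> options E L A" "G' = induced E R" by blast
    moreover from this have "A - (A - R) = R" by (auto simp: options_def)
    ultimately show "G' \<in> ?l"
      by (auto simp: csg_move_induced_iff [OF assms] options_def intro!: exI [of _ "A - R"])
  qed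
  then show ?thesis
    unfolding gval_def by (subst grundy.simps) (simp add: image_image)
qed

section \<open>Cuts, roots and images of connected vertex sets\<close>

lemma conn_nonempty: "conn E S \<Longrightarrow> S \<noteq> {}"
  by (simp add: conn_def)

text \<open>A walk in \<open>S\<close> from a point of \<open>A\<close> to a point outside
  \<open>A\<close> crosses the boundary.\<close>

lemma conn_cut:
  assumes "conn E S" and "A \<subseteq> S" "A \<noteq> {}" "A \<noteq> S"
  obtains a b where "a \<in> A" "b \<in> S - A" "(a, b) \<in> E"
proof -
  obtain x y where xy: "x \<in> A" "y \<in> S" "y \<notin> A" using assms by blast
  then have "(x, y) \<in> (E \<inter> S \<times> S)\<^sup>*" using assms by (auto simp: conn_def)
  then have "\<exists>a\<in>A. \<exists>b\<in>S - A. (a, b) \<in> E"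
    using xy(1,3) by (induction rule: rtrancl_induct) auto
  then show ?thesis using that by blast
qed

lemma conn_rootI:
  assumes "sym E" and "r \<in> S" and root: "\<And>x. x \<in> S \<Longrightarrow> (r, x) \<in> (E \<inter> S \<times> S)\<^sup>*"
  shows "conn E S"
proof -
  have "sym (E \<inter> S \<times> S)" using assms(1) by (auto simp: sym_def)
  then have "sym ((E \<inter> S \<times> S)\<^sup>*)" by (rule sym_rtrancl)
  then have "(x, r) \<in> (E \<inter> S \<times> S)\<^sup>*" if "x \<in> S" for x
    using root [OF that] by (rule symD)
  with assms(2) root show ?thesis
    unfolding conn_def by (metis empty_iff rtrancl_trans)
qed

text \<open>Allowing \<open>f x = f y\<close> lets edges collapse, so that both embeddings and
  contractions are covered.\<close>

lemma conn_image:
  assumes "conn E S"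
    and step: "\<And>x y. x \<in> S \<Longrightarrow> y \<in> S \<Longrightarrow> (x, y) \<in> E \<Longrightarrow> f x = f y \<or> (f x, f y) \<in> F"
  shows "conn F (f ` S)"
proof -
  have "(f x, f y) \<in> (F \<inter> f ` S \<times> f ` S)\<^sup>*" if "(x, y) \<in> (E \<inter> S \<times> S)\<^sup>*" for x y
    using that
  proof (induction rule: rtrancl_induct)
    case (step y z)
    then have "f y = f z \<or> (f y, f z) \<in> F \<inter> f ` S \<times> f ` S" using assms(2) by blast
    with step.IH show ?case by (metis rtrancl.rtrancl_into_rtrancl)
  qed simp
  with assms(1) show ?thesis by (auto simp: conn_def)
qed

lemma downward_closed_nat:
  fixes J :: "nat set"
  assumes "finite J" and "\<And>i j. j \<in> J \<Longrightarrow> i < j \<Longrightarrow> i \<in> J"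
  shows "\<exists>m. J = {..<m}"
proof (cases "J = {}")
  case False
  with assms have "J = {..<Suc (Max J)}"
    by (auto simp: less_Suc_eq_le) (metis Max_in False le_neq_implies_less)
  then show ?thesis by blast
qed (auto intro: exI [of _ 0])

section \<open>Disjoint sums of core vertices and path vertices\<close>

lemma Inl_in_Plus_iff [simp]: "Inl x \<in> A <+> B \<longleftrightarrow> x \<in> A"
  and Inr_in_Plus_iff [simp]: "Inr y \<in> A <+> B \<longleftrightarrow> y \<in> B"
  by auto

lemma Plus_Diff: "(A <+> B) - (C <+> D) = (A - C) <+> (B - D)"
  by auto

lemma Plus_subset_iff: "A <+> B \<subseteq> C <+> D \<longleftrightarrow> A \<subseteq> C \<and> B \<subseteq> D"
  by auto

lemma Plus_eq_empty_iff: "A <+> B = {} \<longleftrightarrow> A = {} \<and> B = {}"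
  by auto

lemma set_eq_Plus: "S = Inl -` S <+> Inr -` S"
proof (intro set_eqI)
  fix x show "x \<in> S \<longleftrightarrow> x \<in> Inl -` S <+> Inr -` S" by (cases x) auto
qed

lemma in_symcl_iff: "(x, y) \<in> R\<^sup>s \<longleftrightarrow> (x, y) \<in> R \<or> (y, x) \<in> R"
  by (force simp: symcl_def)

section \<open>The graph with a ray attached at \<open>u\<close>\<close>

text \<open>The ray is infinite so that one relation hosts the appended paths of all lengths; length
  \<open>k\<close> is recovered by restricting the path vertices to \<open>{..<k}\<close>.\<close>

definition ray_graph :: "'a pair_pre_digraph \<Rightarrow> 'a \<Rightarrow> ('a + nat) rel" where
  "ray_graph G u =
     ({(Inl v, Inl w) |v w. (v, w) \<in> parcs G} \<union> {(Inr i, Inr (Suc i)) |i. True} \<union> {(Inl u, Inr 0)})\<^sup>s"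

locale ray_extension = pair_graph G for G :: "'a pair_pre_digraph" +
  fixes u :: 'a and L :: "nat set" and M :: nat
  assumes L_bound: "l \<in> L \<Longrightarrow> 0 < l \<and> l \<le> M"
begin

abbreviation "E \<equiv> ray_graph G u"

lemma sym_E: "sym E"
  unfolding ray_graph_def by (auto simp: in_symcl_iff sym_def)

lemma E_simps [simp]:
  "(Inl v, Inl w) \<in> E \<longleftrightarrow> (v, w) \<in> parcs G"
  "(Inr i, Inr j) \<in> E \<longleftrightarrow> j = Suc i \<or> i = Suc j"
  "(Inl v, Inr i) \<in> E \<longleftrightarrow> v = u \<and> i = 0"
  "(Inr i, Inl v) \<in> E \<longleftrightarrow> v = u \<and> i = 0"
  using pair_sym_arcs
  by (auto simp: ray_graph_def in_symcl_iff symmetric_def dest: symD)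

lemma irrefl_E: "irrefl E"
proof -
  have "(x, x) \<notin> E" for x
    by (cases x) (auto dest: no_loops')
  then show ?thesis by (simp add: irrefl_def)
qed

lemma finite_L: "finite L"
  by (rule finite_subset [of _ "{..M}"]) (auto dest: L_bound)

lemma with_proj_append_path:
  assumes "u \<in> pverts G"
  shows "with_proj (append_path G u k) = induced E (pverts G <+> {..<k})"
proof -
  have "parcs (append_path G u k) = E \<inter> (pverts G <+> {..<k}) \<times> (pverts G <+> {..<k})"
    using assms
    by (auto simp: append_path_def ray_graph_def in_symcl_iff dest: in_arcsD1 in_arcsD2
        split: if_splits)
  then show ?thesis
    by (simp add: induced_def with_proj_def) (simp add: append_path_def Plus_def)
qed

lemma conn_interval:
  assumes "a < b"
  shows "conn E ({} <+> {a..<b})"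
proof (rule conn_rootI [OF sym_E, of "Inr a"])
  let ?S = "({} :: 'a set) <+> {a..<b}"
  fix x assume "x \<in> ?S"
  then obtain i where i: "x = Inr i" "a \<le> i" "i < b" by auto
  have "i < b \<longrightarrow> (Inr a, Inr i) \<in> (E \<inter> ?S \<times> ?S)\<^sup>*"
    using i(2)
  proof (induction i rule: dec_induct)
    case (step n)
    then have "n < b \<and> Suc n < b \<Longrightarrow> (Inr n, Inr (Suc n)) \<in> E \<inter> ?S \<times> ?S" by simp
    with step show ?case by (metis Suc_lessD rtrancl.rtrancl_into_rtrancl)
  qed simp
  with i show "(Inr a, x) \<in> (E \<inter> ?S \<times> ?S)\<^sup>*" by simp
qed (use assms in auto)

lemma conn_append_ray:
  assumes "conn E (W <+> {})" "u \<in> W"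
  shows "conn E (W <+> {..<k})"
proof (rule conn_rootI [OF sym_E, of "Inl u"])
  let ?S = "W <+> {..<k}"
  fix x assume x: "x \<in> ?S"
  show "(Inl u, x) \<in> (E \<inter> ?S \<times> ?S)\<^sup>*"
  proof (cases x)
    case (Inl v)
    then have "(Inl u, x) \<in> (E \<inter> (W <+> {}) \<times> (W <+> {}))\<^sup>*"
      using x assms by (auto simp: conn_def)
    then show ?thesis by (rule rev_subsetD) (intro rtrancl_mono; auto)
  next
    case (Inr i)
    have "i < k \<longrightarrow> (Inl u, Inr i) \<in> (E \<inter> ?S \<times> ?S)\<^sup>*"
    proof (induction i)
      case 0
      then show ?case using assms(2) by (auto intro!: r_into_rtrancl)
    next
      case (Suc n)
      have "Suc n < k \<Longrightarrow> (Inr n, Inr (Suc n)) \<in> E \<inter> ?S \<times> ?S" by simp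
      with Suc show ?case by (metis Suc_lessD rtrancl.rtrancl_into_rtrancl)
    qed
    with Inr x show ?thesis by auto
  qed
qed (use assms in auto)

text \<open>The only edge between the two summands joins \<open>Inl u\<close> to
  \<open>Inr 0\<close>.\<close>

lemma conn_without_root:
  assumes "conn E (X <+> J)" and "u \<notin> X"
  shows "X = {} \<or> J = {}"
proof (rule ccontr)
  assume "\<not> ?thesis"
  then obtain a b where "a \<in> X <+> {}" "b \<in> (X <+> J) - (X <+> {})" "(a, b) \<in> E"
    by (auto intro: conn_cut [OF assms(1), of "X <+> {}"])
  with assms(2) show False by auto
qed

text \<open>Every route from before position \<open>j\<close> to position \<open>k\<close> passes
  \<open>Inr j\<close>. The last hypothesis ensures that something lies before \<open>j\<close>: a
  core vertex or an earlier path vertex.\<close>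

lemma conn_no_gap:
  assumes "conn E (X <+> J)" and "k \<in> J" "j < k" and "X \<noteq> {} \<or> (\<exists>i<j. i \<in> J)"
  shows "j \<in> J"
proof (rule ccontr)
  assume j: "j \<notin> J"
  \<comment> \<open>The part before the gap: an edge leaving it would have to end in
    \<open>Inr j\<close>.\<close>
  let ?A = "X <+> {i \<in> J. i < j}"
  have "Inr k \<in> (X <+> J) - ?A" using assms by auto
  then have "?A \<noteq> X <+> J" by blast
  moreover have "?A \<noteq> {}" using assms(4) by auto
  ultimately obtain a b where "a \<in> ?A" "b \<in> (X <+> J) - ?A" "(a, b) \<in> E"
    using conn_cut [OF assms(1), of ?A] by auto
  with j show False
    by auto (metis Suc_lessI gr0I)+
qed

text \<open>Collapsing the path onto \<open>u\<close> is a retraction.\<close>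

lemma conn_retract:
  assumes "conn E (X <+> J)" and "u \<in> X"
  shows "conn E (X <+> {})"
proof -
  let ?f = "case_sum Inl (\<lambda>i. Inl u) :: 'a + nat \<Rightarrow> 'a + nat"
  have "conn E (?f ` (X <+> J))"
    by (rule conn_image [OF assms(1)]) (auto split: sum.splits)
  moreover have "?f ` (X <+> J) = X <+> {}"
    using assms(2) by (force simp: image_iff Plus_def)
  ultimately show ?thesis by simp
qed

lemma conn_Inr_interval:
  assumes "conn E ({} <+> D)" "finite D"
  obtains c d where "c < d" "D = {c..<d}"
proof
  have ne: "D \<noteq> {}" using conn_nonempty [OF assms(1)] by auto
  have Min: "Min D \<in> D" "\<And>i. i \<in> D \<Longrightarrow> Min D \<le> i" and Max: "Max D \<in> D" "\<And>i. i \<in> D \<Longrightarrow> i \<le> Max D"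
    using ne assms(2) by auto
  show "Min D < Suc (Max D)" using Min Max by (simp add: less_Suc_eq_le)
  have "i \<in> D" if "Min D \<le> i" "i \<le> Max D" for i
    using conn_no_gap [OF assms(1), of "Max D" i] Min(1) Max(1) that
    by (metis le_neq_implies_less)
  then show "D = {Min D..<Suc (Max D)}"
    using Min(2) Max(2) by (auto simp: less_Suc_eq_le)
qed

section \<open>Options of paths and of graphs with a long path appended\<close>

text \<open>The removed piece is an interval, and it touches an end because otherwise the rest would
  split in two.\<close>

lemma options_interval:
  "options E L ({} <+> {a..<b}) =
     (\<lambda>l. {} <+> {a + l..<b}) ` {l \<in> L. l \<le> b - a} \<union> (\<lambda>l. {} <+> {a..<b - l}) ` {l \<in> L. l \<le> b - a}"
  (is "?l = ?r")
proof (intro subset_antisym subsetI)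
  fix R assume R: "R \<in> ?l"
  define J where "J = Inr -` R"
  have R_eq: "R = {} <+> J" and J: "J \<subseteq> {a..<b}"
    using R set_eq_Plus [of R] by (auto simp: options_def J_def)
  define D where "D = {a..<b} - J"
  have diff: "({} <+> {a..<b}) - R = {} <+> D"
    by (simp add: R_eq D_def Plus_Diff)
  have D: "conn E ({} <+> D)" "card D \<in> L" and R': "J = {} \<or> conn E ({} <+> J)"
    using R unfolding options_def mem_Collect_eq diff
    by (auto simp: R_eq Plus_eq_empty_iff card_Plus D_def)
  obtain c d where cd: "c < d" "D = {c..<d}"
    using conn_Inr_interval [OF D(1)] by (auto simp: D_def)
  then have "{c..<d} \<subseteq> {a..<b}" unfolding D_def by blast
  then have ab: "a \<le> c" "d \<le> b" using cd(1) by auto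
  have J_eq: "J = {a..<b} - {c..<d}" using J cd(2) unfolding D_def by blast
  \<comment> \<open>If neither end were touched, \<open>a\<close> and \<open>b - 1\<close> would
    both survive with the gap \<open>c\<close> between them.\<close>
  have "c = a \<or> d = b"
  proof (rule ccontr)
    assume "\<not> ?thesis"
    with ab cd(1) have "a \<in> J" "b - 1 \<in> J" "c \<notin> J" "a < c" "c < b - 1" by (auto simp: J_eq)
    with R' conn_no_gap [of "{}" J "b - 1" c] show False by blast
  qed
  then show "R \<in> ?r"
  proof
    assume "c = a"
    then have "J = {a + (d - a)..<b}" using ab cd(1) J_eq by auto
    then show ?thesis
      using D(2) ab cd \<open>c = a\<close> by (auto simp: R_eq intro!: image_eqI [of _ _ "d - a"])
  next
    assume "d = b"
    then have "J = {a..<b - (b - c)}" using ab cd(1) J_eq by auto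
    then show ?thesis
      using D(2) ab cd \<open>d = b\<close> by (auto simp: R_eq intro!: image_eqI [of _ _ "b - c"])
  qed
next
  fix R assume "R \<in> ?r"
  then consider l where "l \<in> L" "l \<le> b - a" "R = {} <+> {a + l..<b}"
    | l where "l \<in> L" "l \<le> b - a" "R = {} <+> {a..<b - l}" by blast
  then show "R \<in> ?l"
  proof cases
    case 1
    then have *: "{a..<b} - {a + l..<b} = {a..<a + l}" using L_bound by auto
    have "R = {} \<or> conn E R"
      using conn_interval [of "a + l" b] 1(3) by (cases "a + l < b") auto
    then show ?thesis
      using 1 L_bound [OF 1(1)] conn_interval [of a "a + l"]
      by (simp add: options_def Plus_Diff Plus_subset_iff * card_Plus)
  next
    case 2
    then have *: "{a..<b} - {a..<b - l} = {b - l..<b}" using L_bound [OF 2(1)] by auto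
    have "R = {} \<or> conn E R"
      using conn_interval [of a "b - l"] 2(3) by (cases "a < b - l") auto
    then show ?thesis
      using 2 L_bound [OF 2(1)] conn_interval [of "b - l" b]
      by (auto simp: options_def Plus_Diff Plus_subset_iff * card_Plus)
  qed
qed

text \<open>These moves delete core vertices but keep \<open>u\<close>, so a path at
  \<open>u\<close> stays attached. They do not depend on the path length, which makes induction on
  \<open>W\<close> possible.\<close>

definition core_opts :: "'a set \<Rightarrow> 'a set set" where
  "core_opts W = {W'. W' \<subseteq> W \<and> u \<in> W' \<and> conn E (W' <+> {}) \<and>
     conn E ((W - W') <+> {}) \<and> card (W - W') \<in> L}"

text \<open>The removed set and the remaining set are both connected, and whichever misses
  \<open>u\<close> lies entirely in the core or entirely on the path.\<close>

lemma options_append: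
  assumes "finite W" "u \<in> W" "conn E (W <+> {})" "M < k"
  shows "options E L (W <+> {..<k}) =
     (\<lambda>l. W <+> {..<k - l}) ` L \<union> (\<lambda>W'. W' <+> {..<k}) ` core_opts W
       \<union> (\<lambda>a. {} <+> {a..<k}) ` {a. card W + a \<in> L}"
    (is "?l = ?r")
proof (intro subset_antisym subsetI)
  fix R assume R: "R \<in> ?l"
  define X where "X = Inl -` R"
  define J where "J = Inr -` R"
  define D where "D = {..<k} - J"
  have R_eq: "R = X <+> J"
    using set_eq_Plus [of R] by (simp add: X_def J_def)
  have sub: "X \<subseteq> W" "J \<subseteq> {..<k}"
    using R by (auto simp: options_def R_eq)
  have diff: "(W <+> {..<k}) - R = (W - X) <+> D"
    by (simp add: R_eq D_def Plus_Diff)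
  have conn_diff: "conn E ((W - X) <+> D)" and card: "card (W - X) + card D \<in> L"
    using R assms(1) unfolding options_def mem_Collect_eq diff
    by (auto simp: card_Plus D_def)
  have J_eq: "J = {..<k} - D" using sub(2) by (auto simp: D_def)
  have fin: "finite J" "finite D" using sub(2) by (auto simp: D_def dest: finite_subset)
  \<comment> \<open>At most \<open>M\<close> vertices are removed, so part of the path survives and
    the remaining set is nonempty.\<close>
  have "card D < k" using card L_bound assms(4) by (meson add_leD2 le_less_trans)
  then have "J \<noteq> {}" by (auto simp: D_def)
  then have conn_R: "conn E (X <+> J)" using R by (auto simp: options_def R_eq)
  show "R \<in> ?r"
  proof (cases "u \<in> X")
    case True
    \<comment> \<open>With \<open>u\<close> kept, the surviving part of the path has no gaps and
      starts at 0; the removed set misses \<open>u\<close> and so lies on one side.\<close>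
    then obtain m where m: "J = {..<m}"
      using downward_closed_nat [OF fin(1)] conn_no_gap [OF conn_R] by blast
    have "W - X = {} \<or> D = {}"
      using conn_without_root [OF conn_diff] True by blast
    then show ?thesis
    proof
      assume "W - X = {}"
      moreover have "m \<le> k" using sub(2) m by simp
      then have "D = {m..<k}" "m = k - (k - m)" by (auto simp: D_def m)
      ultimately show ?thesis
        using card sub m by (auto simp: R_eq intro!: image_eqI [of _ _ "k - m"])
    next
      assume "D = {}"
      then have "X \<in> core_opts W"
        using True sub(1) card conn_diff conn_retract [OF conn_R] by (simp add: core_opts_def)
      then show ?thesis using J_eq \<open>D = {}\<close> by (auto simp: R_eq)
    qed
  next
    case False
    \<comment> \<open>With \<open>u\<close> removed, the remainder lies on the path, and the removed
      path vertices form an initial segment because they are connected to \<open>u\<close>.\<close>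
    then have X: "X = {}" using conn_without_root [OF conn_R] \<open>J \<noteq> {}\<close> by blast
    then obtain a where a: "D = {..<a}"
      using downward_closed_nat [OF fin(2)] conn_no_gap [OF conn_diff] assms(2) by blast
    then have "J = {a..<k}" using J_eq by auto
    then show ?thesis using card X a by (auto simp: R_eq)
  qed
next
  fix R assume "R \<in> ?r"
  then consider l where "l \<in> L" "R = W <+> {..<k - l}"
    | W' where "W' \<in> core_opts W" "R = W' <+> {..<k}"
    | a where "card W + a \<in> L" "R = {} <+> {a..<k}" by blast
  then show "R \<in> ?l"
  proof cases
    case 1
    then have *: "{..<k} - {..<k - l} = {k - l..<k}" by auto
    show ?thesis
      using 1 L_bound [OF 1(1)] assms conn_append_ray [OF assms(3,2)] conn_interval [of "k - l" k]
      by (auto simp: options_def Plus_Diff Plus_subset_iff * card_Plus)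
  next
    case 2
    then show ?thesis
      using assms conn_append_ray [of W' k]
      by (auto simp: options_def core_opts_def Plus_Diff Plus_subset_iff card_Plus)
  next
    case 3
    then have "a < k" using L_bound assms(4) by (meson add_leD2 le_less_trans)
    then have *: "{..<k} - {a..<k} = {..<a}" by auto
    show ?thesis
      using 3 \<open>a < k\<close> assms conn_append_ray [OF assms(3,2)] conn_interval [of a k]
      by (auto simp: options_def Plus_Diff Plus_subset_iff * card_Plus)
  qed
qed

section \<open>Periodicity of the Grundy values\<close>

abbreviation path_val :: "nat \<Rightarrow> nat \<Rightarrow> nat" where
  "path_val a b \<equiv> gval E L ({} <+> {a..<b})"

lemma path_val_unfold:
  "path_val a b = mex ((\<lambda>l. path_val (a + l) b) ` {l \<in> L. l \<le> b - a} \<union>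
    (\<lambda>l. path_val a (b - l)) ` {l \<in> L. l \<le> b - a})"
proof -
  have "path_val a b = mex (gval E L ` options E L ({} <+> {a..<b}))"
    by (rule gval_rec [OF sym_E irrefl_E]) simp
  then show ?thesis by (simp only: options_interval image_Un image_image)
qed

text \<open>Cutting \<open>l\<close> vertices from either end leaves an interval of the same length.
  By induction on the length, both families of options therefore have the same values.\<close>

lemma path_val_shift: "path_val a b = path_val 0 (b - a)"
proof (induction "b - a" arbitrary: a b rule: less_induct)
  case (less a b)
  \<comment> \<open>The right-hand side does not mention \<open>c\<close> and \<open>d\<close>, so
    this applies both to \<open>{a..<b}\<close> and to its translate
    \<open>{0..<b - a}\<close>.\<close>
  have rec: "path_val c d = mex ((\<lambda>l. path_val 0 (b - a - l)) ` {l \<in> L. l \<le> b - a})"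
    if eq: "d - c = b - a" for c d
  proof -
    have "path_val (c + l) d = path_val 0 (b - a - l)" "path_val c (d - l) = path_val 0 (b - a - l)"
      if "l \<in> {l \<in> L. l \<le> b - a}" for l
    proof -
      have *: "d - (c + l) = b - a - l" "d - l - c = b - a - l" "b - a - l < b - a"
        using that eq L_bound [of l] by auto
      show "path_val (c + l) d = path_val 0 (b - a - l)"
        using less [of d "c + l"] *(3) unfolding *(1,2) by blast
      show "path_val c (d - l) = path_val 0 (b - a - l)"
        using less [of "d - l" c] *(3) unfolding *(1,2) by blast
    qed
    then have "(\<lambda>l. path_val (c + l) d) ` {l \<in> L. l \<le> b - a} =
        (\<lambda>l. path_val 0 (b - a - l)) ` {l \<in> L. l \<le> b - a}"
      "(\<lambda>l. path_val c (d - l)) ` {l \<in> L. l \<le> b - a} =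
        (\<lambda>l. path_val 0 (b - a - l)) ` {l \<in> L. l \<le> b - a}"
      by (intro image_cong; blast)+
    then show ?thesis using path_val_unfold [of c d] by (simp only: eq Un_absorb)
  qed
  show ?case using rec [of b a] rec [of "b - a" 0] by simp
qed

text \<open>For \<open>k > M\<close> every size in \<open>L\<close> fits, and both ends yield the
  same values, so the recursion holds with the constant empty set as its periodic part.\<close>

lemma ult_periodic_path_val: "ult_periodic (\<lambda>n. path_val 0 n)"
proof (rule ult_periodic_mex_recursion [OF finite_L L_bound ult_periodic_const])
  fix k assume "k > M"
  then have "{l \<in> L. l \<le> k} = L" using L_bound by force
  moreover have "path_val l k = path_val 0 (k - l)" for l by (rule path_val_shift)
  ultimately show "path_val 0 k = mex ({} \<union> (\<lambda>l. path_val 0 (k - l)) ` L)"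
    by (subst path_val_unfold) simp
qed auto

lemma ult_periodic_gval_append:
  assumes "finite W" "u \<in> W" "conn E (W <+> {})"
  shows "ult_periodic (\<lambda>k. gval E L (W <+> {..<k}))"
  using assms
proof (induction W rule: finite_psubset_induct)
  case (psubset W)
  let ?A = "{a. card W + a \<in> L}"
  \<comment> \<open>These are the values of the options other than shortening the path, written as
    unions of singletons over finite index sets that do not vary with \<open>k\<close>.\<close>
  let ?X = "\<lambda>k. (\<Union>W'\<in>core_opts W. {gval E L (W' <+> {..<k})}) \<union> (\<Union>a\<in>?A. {path_val a k})"
  have fin_core: "finite (core_opts W)"
    by (rule finite_subset [of _ "Pow W"]) (use psubset.hyps in \<open>auto simp: core_opts_def\<close>)
  have fin_A: "finite ?A"
    by (rule finite_subset [of _ "{..M}"]) (auto dest: L_bound)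
  have "ult_periodic (\<lambda>k. {gval E L (W' <+> {..<k})})" if W': "W' \<in> core_opts W" for W'
  proof -
    \<comment> \<open>The deleted core part is connected, hence nonempty, so the induction
      hypothesis applies to a proper subset of \<open>W\<close>.\<close>
    have "W - W' \<noteq> {}" using W' conn_nonempty by (fastforce simp: core_opts_def)
    with W' have "W' \<subset> W" by (auto simp: core_opts_def)
    with W' psubset.IH have "ult_periodic (\<lambda>k. gval E L (W' <+> {..<k}))"
      by (simp add: core_opts_def)
    then show ?thesis by (rule ult_periodic_comp)
  qed
  moreover have "ult_periodic (\<lambda>k. {path_val a k})" for a
  proof -
    have "(\<lambda>k. path_val a k) = (\<lambda>k. path_val 0 (k - a))"
      by (rule ext) (rule path_val_shift)
    then have "ult_periodic (\<lambda>k. path_val a k)"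
      using ult_periodic_shift [OF ult_periodic_path_val] by simp
    then show ?thesis by (rule ult_periodic_comp)
  qed
  ultimately have per: "ult_periodic ?X"
    using fin_core fin_A by (intro ult_periodic_Un ult_periodic_UN)
  show ?case
  proof (rule ult_periodic_mex_recursion [OF finite_L L_bound per])
    fix k assume k: "k > M"
    have "gval E L (W <+> {..<k}) = mex (gval E L ` options E L (W <+> {..<k}))"
      by (rule gval_rec [OF sym_E irrefl_E]) (simp add: psubset.hyps)
    also have "gval E L ` options E L (W <+> {..<k}) = ?X k \<union> (\<lambda>l. gval E L (W <+> {..<k - l})) ` L"
      by (subst options_append [OF psubset.hyps psubset.prems k]) auto
    finally show "gval E L (W <+> {..<k}) = mex (?X k \<union> (\<lambda>l. gval E L (W <+> {..<k - l})) ` L)" .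
  qed (use fin_core fin_A in auto)
qed

end

theorem theorem1:
  fixes L :: "nat set" and G :: "'a pair_pre_digraph" and u :: 'a
  assumes "finite L" and "\<forall>l\<in>L. 0 < l"
    and "pair_graph G" and "connected (with_proj G)" and "u \<in> pverts G"
  shows "\<exists>T>0. \<exists>k\<^sub>0. \<forall>k\<ge>k\<^sub>0. csg_path_fun L G u (k + T) = csg_path_fun L G u k"
proof -
  interpret pair_graph G by (rule assms)
  \<comment> \<open>For empty \<open>L\<close> the value of \<open>Max L\<close> is unspecified, but
    the required bound holds vacuously.\<close>
  interpret ray_extension G u L "Max L"
    using assms by unfold_locales auto
  have "conn (parcs G) (pverts G)"
    using assms(4) pair_sym_arcs
    by (subst (asm) connected_with_proj_iff) (auto simp: symmetric_def dest: in_arcsD1 in_arcsD2)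
  then have "conn E (Inl ` pverts G)"
    by (rule conn_image) simp
  then have "conn E (pverts G <+> {})"
    by (simp add: Plus_def)
  then have "ult_periodic (csg_path_fun L G u)"
    using ult_periodic_gval_append [of "pverts G"] assms(5) pair_finite_verts
    by (simp add: csg_path_fun_def [abs_def] with_proj_append_path gval_def)
  then show ?thesis
    unfolding ult_periodic_def .
qed

end
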